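(* Let $U,I\ge 1$ and let $\mathbf{R}\in\{0,1\}^{U\times I}$ be a user-item interaction matrix with no zero row and no zero column, whose user-item bipartite network $\mathcal{G}$ is connected. Let $\mathbf{W}\in\mathbb{R}^{I\times I}$ be an arbitrary entrywise non-negative, nonzero matrix (the item model). For $\alpha\in(0,1)$ let $\mathbf{P}=\mathbf{P}_\alpha$ be the RecWalk transition probability matrix built from $\mathbf{R}$, $\mathbf{W}$ and $\alpha$, and let $\lambda(\mathbf{P})$ be the set of eigenvalues of $\mathbf{P}$. Then, irrespectively of the item model $\mathbf{W}$ used: (a) for every $\alpha\in(0,1)$, $1-2\alpha\in\lambda(\mathbf{P}_\alpha)$; (b) when $\alpha$ is small enough, the Markov chain with transition probability matrix $\mathbf{P}_\alpha$ is nearly uncoupled into at least $U+1$ blocks; that is, for every $\delta>0$ there exists $\alpha_0\in(0,1)$ such that for every $\alpha\in(0,\alpha_0)$ there is a partition of the state space into at least $U+1$ nonempty blocks with respect to which the maximum degree of coupling of $\mathbf{P}_\alpha$ is at most $\delta$.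
   Context: Let $\mathcal{U}=\{1,\dots,U\}$ be the users and $\mathcal{I}=\{1,\dots,I\}$ the items. $\mathbf{R}$ is the $U\times I$ matrix with $R_{ui}=1$ if user $u$ has interacted with item $i$ and $0$ otherwise. The user-item bipartite network $\mathcal{G}$ is the undirected graph on the disjoint union $\mathcal{U}\cup\mathcal{I}$ with adjacency matrix $\mathbf{A}_{\mathcal{G}}=\begin{bmatrix}\mathbf{0}&\mathbf{R}\\ \mathbf{R}^{\top}&\mathbf{0}\end{bmatrix}\in\mathbb{R}^{(U+I)\times(U+I)}$. Vectors are columns; $\mathbf{1}$ is the all-ones vector; $\operatorname{Diag}(\mathbf{v})$ is the diagonal matrix with $\mathbf{v}$ on its diagonal; $\|\mathbf{W}\|_\infty$ is the maximum row-sum of the non-negative matrix $\mathbf{W}$. RecWalk transition probability matrix: for $0<\alpha<1$, $$\mathbf{P}=\alpha\mathbf{H}+(1-\alpha)\mathbf{M},\qquad \mathbf{H}=\operatorname{Diag}(\mathbf{A}_{\mathcal{G}}\mathbf{1})^{-1}\mathbf{A}_{\mathcal{G}},\qquad \mathbf{M}=\begin{bmatrix}\mathbf{I}_U&\mathbf{0}\\ \mathbf{0}&\mathbf{M}_{\mathcal{I}}\end{bmatrix},$$ where $\mathbf{I}_U$ is the $U\times U$ identity matrix and $$\mathbf{M}_{\mathcal{I}}=\frac{1}{\|\mathbf{W}\|_\infty}\mathbf{W}+\operatorname{Diag}\Big(\mathbf{1}-\frac{1}{\|\mathbf{W}\|_\infty}\mathbf{W}\mathbf{1}\Big).$$ Nearly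 uncoupled chains: let $\mathbf{Z}\in\mathbb{R}^{n\times n}$ be the transition probability matrix of an irreducible aperiodic Markov chain, and partition its states into $L$ nonempty blocks. One writes $\mathbf{Z}=\mathbf{Z}^\star+\varepsilon\mathbf{C}$, where $\mathbf{Z}^\star$ is block diagonal with respect to this partition with irreducible stochastic diagonal blocks, the row-sums of $\mathbf{C}$ are zero, in each row the total mass of $\varepsilon\mathbf{C}$ outside the row's own block equals that of $\mathbf{Z}$, and $\varepsilon$ is the maximum degree of coupling between the blocks: $$\varepsilon=\max_{m}\ \sum_{l\,\notin\,\text{block of }m}[\mathbf{Z}]_{ml},$$ i.e. the maximum over states $m$ of the probability of leaving the block of $m$ in a single transition. When $\varepsilon$ is sufficiently small, the chain is called nearly uncoupled into $L$ blocks. *)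

theory Defs
  imports
    "Jordan_Normal_Form.Spectral_Radius"
    "Jordan_Normal_Form.Gauss_Jordan_Elimination"
    "Jordan_Normal_Form.DL_Submatrix"
    "Graph_Theory.Digraph_Component"
    "HOL-Library.Disjoint_Sets"
begin

text \<open>
  Indices are shifted to start at 0. The states of the bipartite network and of the RecWalk
  chain are the numbers below \<open>U + I\<close>: user \<open>u\<close> is state \<open>u\<close> and item \<open>i\<close> is state \<open>U + i\<close>.
\<close>

definition ones_vec :: "nat \<Rightarrow> real vec" where
  "ones_vec n = vec n (\<lambda>_. 1)"

definition Diag :: "real vec \<Rightarrow> real mat" where
  "Diag v = mat_diag (dim_vec v) (\<lambda>i. v $ i)"

definition max_row_sum :: "real mat \<Rightarrow> real" where
  "max_row_sum W = Max ((\<lambda>i. \<Sum>j<dim_col W. W $$ (i, j)) ` {..<dim_row W})"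

definition bip_adj :: "real mat \<Rightarrow> real mat" where
  "bip_adj R = four_block_mat
     (0\<^sub>m (dim_row R) (dim_row R)) R
     (transpose_mat R) (0\<^sub>m (dim_col R) (dim_col R))"

text \<open>An undirected edge is represented by its two arcs; \<^const>\<open>bip_adj\<close> is symmetric.\<close>

definition bip_network :: "real mat \<Rightarrow> nat pair_pre_digraph" where
  "bip_network R =
     (let n = dim_row R + dim_col R in
      \<lparr> pverts = {..<n},
        parcs = {(i, j). i < n \<and> j < n \<and> bip_adj R $$ (i, j) = 1} \<rparr>)"

text \<open>
  \<^const>\<open>mat_inverse\<close> returns an option; the degree matrix is invertible when \<open>R\<close> has
  no zero row and no zero column.
\<close>

definition H_mat :: "real mat \<Rightarrow> real mat" where
  "H_mat R =
     (let A = bip_adj R; n = dim_row R + dim_col R in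
      the (mat_inverse (Diag (A *\<^sub>v ones_vec n))) * A)"

definition M_item :: "real mat \<Rightarrow> real mat" where
  "M_item W =
     (let c = 1 / max_row_sum W; e = ones_vec (dim_row W) in
      c \<cdot>\<^sub>m W + Diag (e - c \<cdot>\<^sub>v (W *\<^sub>v e)))"

definition M_mat :: "nat \<Rightarrow> real mat \<Rightarrow> real mat" where
  "M_mat U W = four_block_mat
     (1\<^sub>m U) (0\<^sub>m U (dim_col W))
     (0\<^sub>m (dim_row W) U) (M_item W)"

definition recwalk :: "real mat \<Rightarrow> real mat \<Rightarrow> real \<Rightarrow> real mat" where
  "recwalk R W \<alpha> = \<alpha> \<cdot>\<^sub>m H_mat R + (1 - \<alpha>) \<cdot>\<^sub>m M_mat (dim_row R) W"

text \<open>A real matrix need not have real eigenvalues only, so its spectrum is taken over the complex numbers.\<close>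

definition eigenvalues :: "real mat \<Rightarrow> complex set" where
  "eigenvalues P = spectrum (map_mat complex_of_real P)"

definition stochastic_mat :: "real mat \<Rightarrow> bool" where
  "stochastic_mat Z \<longleftrightarrow>
     square_mat Z \<and>
     (\<forall>i<dim_row Z. \<forall>j<dim_col Z. 0 \<le> Z $$ (i, j)) \<and>
     (\<forall>i<dim_row Z. (\<Sum>j<dim_col Z. Z $$ (i, j)) = 1)"

definition irreducible_chain :: "real mat \<Rightarrow> bool" where
  "irreducible_chain Z \<longleftrightarrow>
     (\<forall>i<dim_row Z. \<forall>j<dim_row Z. \<exists>k>0. (Z ^\<^sub>m k) $$ (i, j) > 0)"

definition aperiodic_chain :: "real mat \<Rightarrow> bool" where
  "aperiodic_chain Z \<longleftrightarrow>
     (\<forall>i<dim_row Z. Gcd {k. k > 0 \<and> (Z ^\<^sub>m k) $$ (i, i) > 0} = 1)"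

definition block_of :: "nat set set \<Rightarrow> nat \<Rightarrow> nat set" where
  "block_of Q m = (THE B. B \<in> Q \<and> m \<in> B)"

definition exit_mass :: "nat set set \<Rightarrow> real mat \<Rightarrow> nat \<Rightarrow> real" where
  "exit_mass Q Z m = (\<Sum>l\<in>{..<dim_col Z} - block_of Q m. Z $$ (m, l))"

definition max_coupling :: "nat set set \<Rightarrow> real mat \<Rightarrow> real" where
  "max_coupling Q Z = Max (exit_mass Q Z ` {..<dim_row Z})"

text \<open>\<open>Z = Zs + \<epsilon> C\<close> with \<open>Zs\<close> block diagonal and \<open>\<epsilon>\<close> the maximum degree of coupling.\<close>

definition uncoupling_decomposition ::
    "nat set set \<Rightarrow> real mat \<Rightarrow> real mat \<Rightarrow> real mat \<Rightarrow> bool" where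
  "uncoupling_decomposition Q Z Zs C \<longleftrightarrow>
     (let n = dim_row Z; \<epsilon> = max_coupling Q Z in
      Zs \<in> carrier_mat n n \<and> C \<in> carrier_mat n n \<and>
      Z = Zs + \<epsilon> \<cdot>\<^sub>m C \<and>
      (\<forall>m<n. \<forall>l<n. l \<notin> block_of Q m \<longrightarrow> Zs $$ (m, l) = 0) \<and>
      (\<forall>B\<in>Q. stochastic_mat (submatrix Zs B B) \<and> irreducible_chain (submatrix Zs B B)) \<and>
      (\<forall>m<n. (\<Sum>l<n. C $$ (m, l)) = 0) \<and>
      (\<forall>m<n. exit_mass Q (\<epsilon> \<cdot>\<^sub>m C) m = exit_mass Q Z m))"

text \<open>
  ``Nearly uncoupled'' asks for the maximum degree of coupling to be sufficiently small; the
  threshold is the explicit parameter \<open>\<delta>\<close>.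
\<close>

definition nearly_uncoupled :: "real \<Rightarrow> nat set set \<Rightarrow> real mat \<Rightarrow> bool" where
  "nearly_uncoupled \<delta> Q Z \<longleftrightarrow>
     stochastic_mat Z \<and> irreducible_chain Z \<and> aperiodic_chain Z \<and>
     partition_on {..<dim_row Z} Q \<and>
     (\<exists>Zs C. uncoupling_decomposition Q Z Zs C) \<and>
     max_coupling Q Z \<le> \<delta>"

end

theory Submission
  imports Defs
begin

text \<open>
  The vector with value 1 on users and \<open>-1\<close> on items is flipped by \<open>H\<close>, which always changes side,
  and fixed by \<open>M\<close>, which never does; hence it is an eigenvector of \<open>\<alpha> H + (1 - \<alpha>) M\<close>
  for \<open>1 - 2 \<alpha>\<close>. For the same reason every state leaves its block of the partition
  ``each user alone, all items together'' with probability exactly \<open>\<alpha>\<close>. The item block of \<open>M\<close>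
  may be reducible, but the decomposition only prescribes where \<open>Zs\<close> vanishes, so \<open>Zs\<close> can be
  taken uniform on every block whatever the item model is.
\<close>

section \<open>Powers of non-negative matrices\<close>

lemma pow_mat_nonneg:
  fixes Z :: "real mat"
  assumes Z: "Z \<in> carrier_mat n n"
    and nonneg: "\<And>i j. i < n \<Longrightarrow> j < n \<Longrightarrow> 0 \<le> Z $$ (i, j)"
  shows "i < n \<Longrightarrow> j < n \<Longrightarrow> 0 \<le> (Z ^\<^sub>m k) $$ (i, j)"
proof (induction k arbitrary: i j)
  case 0
  then show ?case using Z by simp
next
  case (Suc k)
  have "Z ^\<^sub>m k \<in> carrier_mat n n" using Z by simp
  with Suc Z nonneg show ?case
    by (auto simp: scalar_prod_def intro!: sum_nonneg)
qed

text \<open>Non-negative terms cannot cancel, so the single term through \<open>j\<close> already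
  makes the sum positive.\<close>

lemma pow_mat_step_pos:
  fixes Z :: "real mat"
  assumes Z: "Z \<in> carrier_mat n n"
    and nonneg: "\<And>i j. i < n \<Longrightarrow> j < n \<Longrightarrow> 0 \<le> Z $$ (i, j)"
    and ijl: "i < n" "j < n" "l < n"
    and pos: "0 < (Z ^\<^sub>m k) $$ (i, j)" "0 < Z $$ (j, l)"
  shows "0 < (Z ^\<^sub>m Suc k) $$ (i, l)"
proof -
  have Zk: "Z ^\<^sub>m k \<in> carrier_mat n n" using Z by simp
  have "0 < (\<Sum>m = 0..<n. (Z ^\<^sub>m k) $$ (i, m) * Z $$ (m, l))"
    using ijl pos pow_mat_nonneg[OF Z nonneg] nonneg
    by (intro sum_pos2[where i = j]) auto
  then show ?thesis using Z Zk ijl by (simp add: scalar_prod_def)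
qed

lemma pow_mat_one: "Z \<in> carrier_mat n n \<Longrightarrow> Z ^\<^sub>m Suc 0 = (Z :: real mat)"
  by simp

text \<open>Turns irreducibility into reachability in the graph of positive entries. The closure is
  transitive but not reflexive, because the exponent has to be positive.\<close>

lemma trancl_imp_pow_mat_pos:
  fixes Z :: "real mat"
  assumes Z: "Z \<in> carrier_mat n n"
    and nonneg: "\<And>i j. i < n \<Longrightarrow> j < n \<Longrightarrow> 0 \<le> Z $$ (i, j)"
    and "(i, j) \<in> {(i, j). i < n \<and> j < n \<and> 0 < Z $$ (i, j)}\<^sup>+"
  shows "\<exists>k>0. 0 < (Z ^\<^sub>m k) $$ (i, j)"
proof -
  from assms(3) have "i < n \<and> j < n \<and> (\<exists>k>0. 0 < (Z ^\<^sub>m k) $$ (i, j))"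
  proof induction
    case (base j)
    then show ?case using pow_mat_one[OF Z] by (auto intro!: exI[of _ "Suc 0"])
  next
    case (step j l)
    then obtain k where "i < n" "j < n" "l < n" "0 < (Z ^\<^sub>m k) $$ (i, j)" "0 < Z $$ (j, l)" by auto
    from pow_mat_step_pos[OF Z nonneg this] \<open>i < n\<close> \<open>l < n\<close> show ?case
      by (auto simp del: pow_mat.simps intro!: exI[of _ "Suc k"])
  qed
  then show ?thesis by blast
qed

section \<open>Decomposition along a partition\<close>

lemma block_of_eq:
  assumes "partition_on S Q" "B \<in> Q" "m \<in> B"
  shows "block_of Q m = B"
  unfolding block_of_def
  using assms disjointD[OF partition_onD2[OF assms(1)]] by (intro the_equality) blast+

lemma stochastic_irreducible_const_mat:
  assumes "0 < n"
  shows "stochastic_mat (mat n n (\<lambda>_. 1 / real n))"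
    and "irreducible_chain (mat n n (\<lambda>_. 1 / real n))"
proof -
  show "stochastic_mat (mat n n (\<lambda>_. 1 / real n))"
    using assms by (auto simp: stochastic_mat_def)
  have "(mat n n (\<lambda>_. 1 / real n) ^\<^sub>m Suc 0) $$ (i, j) > 0" if "i < n" "j < n" for i j
    using that by (subst pow_mat_one) auto
  then show "irreducible_chain (mat n n (\<lambda>_. 1 / real n))"
    unfolding irreducible_chain_def by (auto simp del: pow_mat.simps intro!: exI[of _ "Suc 0"])
qed

text \<open>Once \<open>Zs\<close> is chosen uniform on each block, \<open>C\<close> is forced to be
  \<open>(Z - Zs) / \<epsilon>\<close>, hence the nonzero coupling. Its rows sum to zero because
  those of \<open>Z\<close> and of \<open>Zs\<close> both sum to 1.\<close>

lemma ex_uncoupling_decomposition: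
  assumes stoch: "stochastic_mat Z" and part: "partition_on {..<dim_row Z} Q"
    and eps: "max_coupling Q Z \<noteq> 0"
  shows "\<exists>Zs C. uncoupling_decomposition Q Z Zs C"
proof -
  define n where "n = dim_row Z"
  define \<epsilon> where "\<epsilon> = max_coupling Q Z"
  define Zs where
    "Zs = mat n n (\<lambda>(m, l). if l \<in> block_of Q m then 1 / real (card (block_of Q m)) else 0)"
  define C where "C = mat n n (\<lambda>ml. (Z $$ ml - Zs $$ ml) / \<epsilon>)"
  have dim: "dim_row Z = n" "dim_col Z = n"
    and Z_sum: "\<And>m. m < n \<Longrightarrow> (\<Sum>l<n. Z $$ (m, l)) = 1"
    using stoch by (auto simp: stochastic_mat_def n_def)
  have \<epsilon>: "\<epsilon> \<noteq> 0" using eps by (simp add: \<epsilon>_def)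
  have block: "finite B" "0 < card B" "B \<subseteq> {..<n}" if "B \<in> Q" for B
  proof -
    show "B \<subseteq> {..<n}" using partition_onD1[OF part] that by (auto simp: n_def)
    then show "finite B" by (rule finite_subset) simp
    with partition_onD3[OF part] that show "0 < card B" by (auto simp: card_gt_0_iff)
  qed
  have block_of: "block_of Q m \<in> Q" if "m < n" for m
    using partition_onD1[OF part] that block_of_eq[OF part] by (auto simp: n_def)
  have Zs_sum: "(\<Sum>l<n. Zs $$ (m, l)) = 1" if "m < n" for m
  proof -
    note B = block[OF block_of[OF that]]
    have "(\<Sum>l<n. Zs $$ (m, l)) = (\<Sum>l\<in>block_of Q m. 1 / real (card (block_of Q m)))"
      using that B by (intro sum.mono_neutral_cong_right) (auto simp: Zs_def)
    moreover have "block_of Q m \<noteq> {}" using B by auto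
    ultimately show ?thesis using B by simp
  qed
  have sub: "submatrix Zs B B = mat (card B) (card B) (\<lambda>_. 1 / real (card B))" if "B \<in> Q" for B
  proof -
    \<comment> \<open>\<open>submatrix\<close> lists the indices of \<open>B\<close> below
      \<open>n\<close> by \<open>pick\<close>. As \<open>B\<close> lies below \<open>n\<close>,
      these are all of \<open>B\<close>, and every selected entry of \<open>Zs\<close> has its row
      and column in the same block.\<close>
    have card: "{i. i < n \<and> i \<in> B} = B" using block[OF that] by auto
    have pick: "pick B i \<in> B" "pick B i < n" if "i < card B" for i
      using pick_in_set_le[of i B] that block(3)[OF \<open>B \<in> Q\<close>] by auto
    show ?thesis
      using pick block_of_eq[OF part that]
      by (intro eq_matI) (auto simp: submatrix_def Zs_def card)
  qed
  have \<epsilon>C: "(\<epsilon> \<cdot>\<^sub>m C) $$ (m, l) = Z $$ (m, l) - Zs $$ (m, l)" if "m < n" "l < n" for m l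
    using that \<epsilon> by (simp add: C_def)
  have C_dim: "dim_row C = n" "dim_col C = n" by (auto simp: C_def)
  have "Z = Zs + \<epsilon> \<cdot>\<^sub>m C"
    by (rule eq_matI) (use \<epsilon> in \<open>auto simp: dim C_def Zs_def\<close>)
  moreover have "(\<Sum>l<n. C $$ (m, l)) = 0" if "m < n" for m
  proof -
    have "(\<Sum>l<n. C $$ (m, l)) = ((\<Sum>l<n. Z $$ (m, l)) - (\<Sum>l<n. Zs $$ (m, l))) / \<epsilon>"
      using that unfolding sum_subtractf[symmetric] sum_divide_distrib by (simp add: C_def)
    with Z_sum Zs_sum that show ?thesis by simp
  qed
  \<comment> \<open>Only entries outside the block of \<open>m\<close> are summed; there
    \<open>Zs\<close> vanishes, so the scaled \<open>C\<close> agrees with \<open>Z\<close>.\<close>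
  moreover have "exit_mass Q (\<epsilon> \<cdot>\<^sub>m C) m = exit_mass Q Z m" if "m < n" for m
    unfolding exit_mass_def using that
    by (auto simp: dim C_dim \<epsilon>C Zs_def simp del: index_smult_mat(1) intro!: sum.cong)
  ultimately have "uncoupling_decomposition Q Z Zs C"
    unfolding uncoupling_decomposition_def Let_def dim \<epsilon>_def[symmetric]
    using block(2) by (auto simp: sub stochastic_irreducible_const_mat) (auto simp: Zs_def C_def)
  then show ?thesis by blast
qed

section \<open>The two components of the RecWalk chain\<close>

text \<open>The reciprocals give a two-sided inverse, so the matrix is a unit and
  \<open>mat_inverse\<close> cannot return \<open>None\<close>; uniqueness of inverses then
  identifies its value.\<close>

lemma mat_inverse_mat_diag:
  fixes f :: "nat \<Rightarrow> real"
  assumes "\<And>i. i < n \<Longrightarrow> f i \<noteq> 0"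
  shows "mat_inverse (mat_diag n f) = Some (mat_diag n (\<lambda>i. 1 / f i))"
proof -
  let ?D = "mat_diag n f" and ?E = "mat_diag n (\<lambda>i. 1 / f i)"
  have D: "?D \<in> carrier_mat n n" and E: "?E \<in> carrier_mat n n" by simp_all
  have DE: "?D * ?E = 1\<^sub>m n" and ED: "?E * ?D = 1\<^sub>m n"
    unfolding mat_diag_diag using assms by (auto simp: mat_diag_def intro!: eq_matI)
  then have "?D \<in> Units (ring_mat TYPE(real) n ())"
    using D E unfolding Units_def ring_mat_def mem_Collect_eq monoid.simps partial_object.simps
    by blast
  then obtain B where B: "mat_inverse ?D = Some B"
    using mat_inverse(1)[OF D, of "()"] by (cases "mat_inverse ?D") auto
  from mat_inverse(2)[OF D B] have B': "?D * B = 1\<^sub>m n" "B \<in> carrier_mat n n" by auto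
  have "B = (?E * ?D) * B" using B' ED by simp
  also have "\<dots> = ?E * (?D * B)" using B' by (simp add: assoc_mult_mat[OF E D B'(2)] del: mat_diag_diag)
  also have "\<dots> = ?E" using B' right_mult_one_mat[OF E] by simp
  finally show ?thesis using B by simp
qed

locale recwalk_data =
  fixes U I :: nat and R W :: "real mat"
  assumes U: "U \<ge> 1" and I: "I \<ge> 1"
    and R: "R \<in> carrier_mat U I"
    and R01: "\<forall>u<U. \<forall>i<I. R $$ (u, i) \<in> {0, 1}"
    and R_row: "\<forall>u<U. row R u \<noteq> 0\<^sub>v I"
    and R_col: "\<forall>i<I. col R i \<noteq> 0\<^sub>v U"
    and conn: "Digraph_Component.connected (with_proj (bip_network R))"
    and W: "W \<in> carrier_mat I I"
    and W_nonneg: "\<forall>i<I. \<forall>j<I. W $$ (i, j) \<ge> 0"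
    and W_nz: "W \<noteq> 0\<^sub>m I I"
begin

abbreviation "n \<equiv> U + I"
abbreviation "A \<equiv> bip_adj R"
abbreviation "H \<equiv> H_mat R"
abbreviation "M \<equiv> M_mat U W"

section \<open>Adjacency in the bipartite network\<close>

lemma A_carrier: "A \<in> carrier_mat n n"
  using R by (simp add: bip_adj_def)

lemma A_index:
  assumes "i < n" "j < n"
  shows "A $$ (i, j) =
    (if i < U \<and> U \<le> j then R $$ (i, j - U) else if U \<le> i \<and> j < U then R $$ (j, i - U) else 0)"
  using R assms by (auto simp: bip_adj_def)

lemma A_sym: "i < n \<Longrightarrow> j < n \<Longrightarrow> A $$ (i, j) = A $$ (j, i)"
  by (auto simp: A_index)

lemma A_01: "i < n \<Longrightarrow> j < n \<Longrightarrow> A $$ (i, j) \<in> {0, 1}"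
  using R01 by (simp add: A_index less_diff_conv2)

lemma A_changes_side: "i < n \<Longrightarrow> j < n \<Longrightarrow> (i < U \<longleftrightarrow> j < U) \<Longrightarrow> A $$ (i, j) = 0"
  by (auto simp: A_index)

text \<open>A user has a neighbour because its row of \<open>R\<close> is nonzero, an item because
  its column is.\<close>

lemma ex_neighbour:
  assumes "i < n"
  obtains j where "j < n" "A $$ (i, j) = 1"
proof (cases "i < U")
  case True
  with R_row have "row R i \<noteq> 0\<^sub>v I" by blast
  then obtain j where "j < I" "R $$ (i, j) \<noteq> 0"
    using R True by (auto simp: vec_eq_iff)
  with True R01 assms show thesis by (intro that[of "U + j"]) (auto simp: A_index)
next
  case False
  with R_col assms have "col R (i - U) \<noteq> 0\<^sub>v U" by auto
  then obtain u where "u < U" "R $$ (u, i - U) \<noteq> 0"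
    using R False assms by (auto simp: vec_eq_iff)
  moreover have "i - U < I" using False assms by auto
  ultimately have "R $$ (u, i - U) = 1" using R01 by blast
  with \<open>u < U\<close> show thesis using False assms by (intro that[of u]) (auto simp: A_index)
qed

section \<open>Degrees and the random walk component \<open>H\<close>\<close>

definition "deg i = (\<Sum>j<n. A $$ (i, j))"

lemma deg_pos:
  assumes "i < n"
  shows "0 < deg i"
proof -
  obtain j where "j < n" "A $$ (i, j) = 1" using ex_neighbour[OF assms] .
  then show ?thesis unfolding deg_def
    using A_01[OF assms] by (intro sum_pos2[where i = j]) (auto, fastforce)
qed

text \<open>Degrees are positive, so the option-valued inverse is the diagonal matrix of their
  reciprocals, and multiplying by it scales the rows of \<open>A\<close>.\<close>

lemma H_eq: "H = mat n n (\<lambda>(i, j). A $$ (i, j) / deg i)"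
proof -
  have dim: "dim_row R = U" "dim_col R = I" using R by auto
  have "A *\<^sub>v ones_vec n = vec n deg"
    using A_carrier by (intro eq_vecI) (auto simp: ones_vec_def deg_def scalar_prod_def lessThan_atLeast0)
  then have D: "Diag (A *\<^sub>v ones_vec n) = mat_diag n deg"
    by (auto simp: Diag_def mat_diag_def intro!: eq_matI)
  have deg_nz: "deg i \<noteq> 0" if "i < n" for i using deg_pos[OF that] by simp
  have "H = mat_diag n (\<lambda>i. 1 / deg i) * A"
    unfolding H_mat_def Let_def dim D by (simp add: mat_inverse_mat_diag[OF deg_nz])
  then show ?thesis by (simp add: mat_diag_mult_left[OF A_carrier])
qed

lemma H_index: "i < n \<Longrightarrow> j < n \<Longrightarrow> H $$ (i, j) = A $$ (i, j) / deg i"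
  by (simp add: H_eq)

lemma H_carrier: "H \<in> carrier_mat n n"
  by (simp add: H_eq)

lemma H_nonneg: "i < n \<Longrightarrow> j < n \<Longrightarrow> 0 \<le> H $$ (i, j)"
  using deg_pos[of i] A_01[of i j] by (auto simp: H_index)

lemma H_sum: "i < n \<Longrightarrow> (\<Sum>j<n. H $$ (i, j)) = 1"
  using deg_pos[of i] by (simp add: H_index sum_divide_distrib[symmetric] deg_def[symmetric])

lemma H_changes_side: "i < n \<Longrightarrow> j < n \<Longrightarrow> (i < U \<longleftrightarrow> j < U) \<Longrightarrow> H $$ (i, j) = 0"
  by (simp add: H_index A_changes_side)

section \<open>Row-sums of the item model and the component \<open>M\<close>\<close>

definition "W_row_sum i = (\<Sum>j<I. W $$ (i, j))"

lemma W_row_sum_le: "i < I \<Longrightarrow> W_row_sum i \<le> max_row_sum W"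
  using W unfolding max_row_sum_def W_row_sum_def by (intro Max_ge) auto

text \<open>A nonzero entry of \<open>W\<close> is positive, hence so is the sum of its row. This
  keeps the normalisation of \<open>W\<close> away from division by zero.\<close>

lemma max_row_sum_pos: "0 < max_row_sum W"
proof -
  obtain i j where ij: "i < I" "j < I" "W $$ (i, j) \<noteq> 0"
    using W_nz W by (auto simp: mat_eq_iff)
  with W_nonneg have "0 < W $$ (i, j)" by (auto simp: less_le)
  then have "0 < W_row_sum i" unfolding W_row_sum_def
    using ij W_nonneg by (intro sum_pos2[where i = j]) auto
  with W_row_sum_le[OF \<open>i < I\<close>] show ?thesis by linarith
qed

lemma M_item_carrier: "M_item W \<in> carrier_mat I I"
  using W by (simp add: M_item_def Let_def Diag_def ones_vec_def mat_diag_def)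

lemma M_item_index:
  assumes "i < I" "j < I"
  shows "M_item W $$ (i, j) =
    W $$ (i, j) / max_row_sum W + (if i = j then 1 - W_row_sum i / max_row_sum W else 0)"
  using W assms
  by (auto simp: M_item_def Let_def Diag_def ones_vec_def mat_diag_def W_row_sum_def
      scalar_prod_def lessThan_atLeast0)

text \<open>Scaling by the largest row-sum leaves every scaled row-sum at most 1, so the diagonal
  correction is non-negative.\<close>

lemma M_item_nonneg: "i < I \<Longrightarrow> j < I \<Longrightarrow> 0 \<le> M_item W $$ (i, j)"
  using max_row_sum_pos W_row_sum_le[of i] W_nonneg by (auto simp: M_item_index)

text \<open>The diagonal correction returns exactly the mass that the scaled row of \<open>W\<close>
  lacks.\<close>

lemma M_item_sum: "i < I \<Longrightarrow> (\<Sum>j<I. M_item W $$ (i, j)) = 1"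
  by (simp add: M_item_index sum.distrib sum_divide_distrib[symmetric] W_row_sum_def[symmetric])

lemma M_carrier: "M \<in> carrier_mat n n"
  using W M_item_carrier by (auto simp: M_mat_def)

lemma M_index:
  assumes "i < n" "j < n"
  shows "M $$ (i, j) =
    (if i < U \<or> j < U then of_bool (i = j) else M_item W $$ (i - U, j - U))"
  using W M_item_carrier assms by (auto simp: M_mat_def)

lemma M_nonneg: "i < n \<Longrightarrow> j < n \<Longrightarrow> 0 \<le> M $$ (i, j)"
  using M_item_nonneg by (auto simp: M_index)

lemma sum_split: "(\<Sum>j<n. f j) = (\<Sum>j<U. f j) + (\<Sum>j<I. f (U + j))" for f :: "nat \<Rightarrow> real"
  by (induction I) (auto simp: add.assoc)

lemma M_sum:
  assumes "i < n"
  shows "(\<Sum>j<n. M $$ (i, j)) = 1"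
proof (cases "i < U")
  case True
  then show ?thesis using assms by (simp add: M_index of_bool_def)
next
  case False
  then show ?thesis using assms M_item_sum[of "i - U"]
    by (simp add: sum_split M_index)
qed

lemma M_keeps_side: "i < n \<Longrightarrow> j < n \<Longrightarrow> (i < U \<longleftrightarrow> \<not> j < U) \<Longrightarrow> M $$ (i, j) = 0"
  by (auto simp: M_index)

section \<open>The RecWalk chain\<close>

abbreviation "P \<equiv> recwalk R W"

lemma P_carrier: "P \<alpha> \<in> carrier_mat n n"
  using H_carrier M_carrier R by (simp add: recwalk_def)

lemma P_index: "i < n \<Longrightarrow> j < n \<Longrightarrow> P \<alpha> $$ (i, j) = \<alpha> * H $$ (i, j) + (1 - \<alpha>) * M $$ (i, j)"
  using H_carrier M_carrier R by (simp add: recwalk_def)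

lemma eigenvalue_recwalk: "complex_of_real (1 - 2 * \<alpha>) \<in> eigenvalues (P \<alpha>)"
proof -
  define s :: "nat \<Rightarrow> real" where "s i = (if i < U then 1 else -1)" for i
  let ?v = "vec n (\<lambda>i. complex_of_real (s i))"
  let ?P = "map_mat complex_of_real (P \<alpha>)"
  have dim: "dim_row (P \<alpha>) = n" "dim_col (P \<alpha>) = n" using P_carrier[of \<alpha>] by auto
  have sum_s: "(\<Sum>j<n. P \<alpha> $$ (i, j) * s j) = (1 - 2 * \<alpha>) * s i" if i: "i < n" for i
  proof -
    \<comment> \<open>If \<open>i\<close> and \<open>j\<close> are on the same side,
      \<open>s j = s i\<close> and the \<open>H\<close> entry is 0; otherwise
      \<open>s j = - s i\<close> and the \<open>M\<close> entry is 0. What remains after summing are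
      the row-sums of \<open>H\<close> and \<open>M\<close>.\<close>
    have "P \<alpha> $$ (i, j) * s j = - \<alpha> * s i * H $$ (i, j) + (1 - \<alpha>) * s i * M $$ (i, j)" if "j < n" for j
      using H_changes_side[OF i that] M_keeps_side[OF i that] i that
      by (cases "i < U \<longleftrightarrow> j < U") (auto simp: P_index s_def)
    then have "(\<Sum>j<n. P \<alpha> $$ (i, j) * s j) =
        - \<alpha> * s i * (\<Sum>j<n. H $$ (i, j)) + (1 - \<alpha>) * s i * (\<Sum>j<n. M $$ (i, j))"
      by (simp add: sum.distrib sum_distrib_left del: mult_minus_left)
    then show ?thesis using H_sum[OF i] M_sum[OF i] by (simp add: algebra_simps)
  qed
  have "?P *\<^sub>v ?v = complex_of_real (1 - 2 * \<alpha>) \<cdot>\<^sub>v ?v"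
  proof (rule eq_vecI)
    fix i assume "i < dim_vec (complex_of_real (1 - 2 * \<alpha>) \<cdot>\<^sub>v ?v)"
    then have i: "i < n" by simp
    have "(?P *\<^sub>v ?v) $ i = complex_of_real (\<Sum>j<n. P \<alpha> $$ (i, j) * s j)"
      using i by (simp add: dim scalar_prod_def lessThan_atLeast0)
    then show "(?P *\<^sub>v ?v) $ i = (complex_of_real (1 - 2 * \<alpha>) \<cdot>\<^sub>v ?v) $ i"
      using i by (simp only: sum_s[OF i]) simp
  qed (simp add: dim)
  \<comment> \<open>State 0 is a user because \<open>U \<ge> 1\<close>, so its entry is 1.\<close>
  moreover have "?v \<noteq> 0\<^sub>v n"
    using U by (auto simp: vec_eq_iff s_def intro!: exI[of _ 0])
  ultimately have "eigenvector ?P ?v (complex_of_real (1 - 2 * \<alpha>))"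
    by (simp add: eigenvector_def dim)
  then show ?thesis by (auto simp: eigenvalues_def spectrum_def eigenvalue_def)
qed

text \<open>\<open>connected\<close> means strong connectivity of the symmetric closure. Since
  \<open>A\<close> is symmetric, that closure adds no arcs, and its walks are walks in the network
  itself.\<close>

lemma adjacency_rtrancl:
  assumes "i < n" "j < n"
  shows "(i, j) \<in> {(i, j). i < n \<and> j < n \<and> A $$ (i, j) = 1}\<^sup>*"
proof -
  have dim: "dim_row R = U" "dim_col R = I" using R by auto
  let ?G = "mk_symmetric (with_proj (bip_network R))"
  have "pverts ?G = {..<n}" by (simp add: bip_network_def dim Let_def)
  moreover have "parcs ?G = {(i, j). i < n \<and> j < n \<and> A $$ (i, j) = 1}"
    by (auto simp: parcs_mk_symmetric bip_network_def dim A_sym Let_def)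
  moreover have "i \<rightarrow>\<^sup>*\<^bsub>with_proj ?G\<^esub> j"
    using conn assms calculation(1) by (auto simp: connected_def strongly_connected_def)
  ultimately show ?thesis
    unfolding reachable_def by (auto dest: rtrancl_on_rtranclI)
qed

section \<open>The partition into single users and the set of all items\<close>

definition user_item_blocks :: "nat set set" where
  "user_item_blocks = insert {U..<n} ((\<lambda>u. {u}) ` {..<U})"

lemma partition_user_item_blocks: "partition_on {..<n} user_item_blocks"
  using I by (auto simp: partition_on_def disjoint_def user_item_blocks_def)

lemma card_user_item_blocks: "card user_item_blocks = U + 1"
proof -
  have "card ((\<lambda>u. {u}) ` {..<U}) = U" by (simp add: card_image)
  \<comment> \<open>The item block contains state \<open>U\<close>, which is not a user. This
    separates it from the user blocks even when \<open>I = 1\<close> and it is itself a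
    singleton.\<close>
  moreover have "{U..<n} \<notin> (\<lambda>u. {u}) ` {..<U}"
  proof
    assume "{U..<n} \<in> (\<lambda>u. {u}) ` {..<U}"
    then obtain u where u: "u < U" "{U..<n} = {u}" by auto
    have "U \<in> {U..<n}" using I by simp
    with u show False by auto
  qed
  ultimately show ?thesis by (simp add: user_item_blocks_def)
qed

lemma block_of_user_item_blocks:
  "i < n \<Longrightarrow> block_of user_item_blocks i = (if i < U then {i} else {U..<n})"
  by (rule block_of_eq[OF partition_user_item_blocks]) (auto simp: user_item_blocks_def)

section \<open>The chain for a fixed \<open>\<alpha>\<close> strictly between 0 and 1\<close>

context
  fixes \<alpha> :: real
  assumes \<alpha>: "0 < \<alpha>" "\<alpha> < 1"
begin

lemma P_nonneg: "i < n \<Longrightarrow> j < n \<Longrightarrow> 0 \<le> P \<alpha> $$ (i, j)"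
  using \<alpha> H_nonneg[of i j] M_nonneg[of i j] by (simp add: P_index)

lemma P_sum:
  assumes "i < n"
  shows "(\<Sum>j<n. P \<alpha> $$ (i, j)) = 1"
proof -
  have "(\<Sum>j<n. P \<alpha> $$ (i, j)) = \<alpha> * (\<Sum>j<n. H $$ (i, j)) + (1 - \<alpha>) * (\<Sum>j<n. M $$ (i, j))"
    using assms by (simp add: P_index sum.distrib sum_distrib_left)
  then show ?thesis using assms by (simp add: H_sum M_sum)
qed

lemma P_adj_pos:
  assumes "i < n" "j < n" "A $$ (i, j) = 1"
  shows "0 < P \<alpha> $$ (i, j)"
  using assms \<alpha> deg_pos[of i] M_nonneg[of i j]
  by (auto simp: P_index H_index intro!: add_pos_nonneg)

text \<open>The identity block of \<open>M\<close> gives each user a self-loop of weight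
  \<open>1 - \<alpha>\<close>; aperiodicity rests on these loops.\<close>

lemma P_user_pos: "i < U \<Longrightarrow> 0 < P \<alpha> $$ (i, i)"
  using \<alpha> H_nonneg[of i i] by (auto simp: P_index M_index intro!: add_nonneg_pos)

lemma stochastic_recwalk: "stochastic_mat (P \<alpha>)"
  using P_carrier[of \<alpha>] P_nonneg P_sum by (auto simp: stochastic_mat_def)

lemma irreducible_recwalk: "irreducible_chain (P \<alpha>)"
proof -
  let ?E = "{(i, j). i < n \<and> j < n \<and> 0 < P \<alpha> $$ (i, j)}"
  have sub: "{(i, j). i < n \<and> j < n \<and> A $$ (i, j) = 1} \<subseteq> ?E"
    using P_adj_pos by auto
  have "(i, j) \<in> ?E\<^sup>+" if ij: "i < n" "j < n" for i j
  proof -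
    \<comment> \<open>A first step to a neighbour makes the walk nonempty even for
      \<open>i = j\<close>, where connectivity alone could yield the empty walk.\<close>
    obtain k where k: "k < n" "A $$ (i, k) = 1" using ex_neighbour[OF \<open>i < n\<close>] .
    have "(i, k) \<in> ?E" using k ij P_adj_pos by auto
    moreover have "(k, j) \<in> ?E\<^sup>*"
      using adjacency_rtrancl[OF k(1) ij(2)] rtrancl_mono[OF sub] by blast
    ultimately show ?thesis by (rule rtrancl_into_trancl2)
  qed
  then have "\<exists>k>0. 0 < (P \<alpha> ^\<^sub>m k) $$ (i, j)" if "i < n" "j < n" for i j
    using trancl_imp_pow_mat_pos[OF P_carrier P_nonneg] that by blast
  then show ?thesis
    using P_carrier[of \<alpha>] by (auto simp: irreducible_chain_def)
qed

text \<open>Users have self-loops. An item may have none, but through a neighbouring user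
  \<open>u\<close> it returns in two steps, and in three by pausing once at \<open>u\<close>; the
  gcd divides the difference 1.\<close>

lemma aperiodic_recwalk: "aperiodic_chain (P \<alpha>)"
proof -
  have step: "0 < (P \<alpha> ^\<^sub>m Suc k) $$ (i, l)"
    if "i < n" "j < n" "l < n" "0 < (P \<alpha> ^\<^sub>m k) $$ (i, j)" "0 < P \<alpha> $$ (j, l)" for i j l k
    using that by (intro pow_mat_step_pos[OF P_carrier]) (auto intro: P_nonneg)
  have one: "P \<alpha> ^\<^sub>m Suc 0 = P \<alpha>" by (rule pow_mat_one[OF P_carrier])
  have "Gcd {k. k > 0 \<and> (P \<alpha> ^\<^sub>m k) $$ (i, i) > 0} = 1" (is "Gcd ?K = 1") if i: "i < n" for i
  proof (cases "i < U")
    case True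
    then have "Suc 0 \<in> ?K" using P_user_pos unfolding mem_Collect_eq one by simp
    then have "Gcd ?K dvd Suc 0" by (rule Gcd_dvd)
    then show ?thesis by simp
  next
    case False
    obtain u where u: "u < n" "A $$ (i, u) = 1" using ex_neighbour[OF i] .
    with False A_changes_side[OF i u(1)] have uU: "u < U" by auto
    have iu: "0 < (P \<alpha> ^\<^sub>m Suc 0) $$ (i, u)" unfolding one by (rule P_adj_pos[OF i u])
    have ui: "0 < P \<alpha> $$ (u, i)" using P_adj_pos[OF u(1) i] A_sym[OF i u(1)] u(2) by simp
    have "Suc (Suc 0) \<in> ?K" using step[OF i u(1) i iu ui] by blast
    moreover have "Suc (Suc (Suc 0)) \<in> ?K"
      using step[OF i u(1) i step[OF i u(1) u(1) iu P_user_pos[OF uU]] ui] by blast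
    ultimately have "Gcd ?K dvd Suc (Suc (Suc 0)) - Suc (Suc 0)"
      by (intro dvd_diff_nat Gcd_dvd)
    then show ?thesis by simp
  qed
  then show ?thesis using P_carrier[of \<alpha>] by (simp add: aperiodic_chain_def)
qed

lemma exit_mass_recwalk:
  assumes i: "i < n"
  shows "exit_mass user_item_blocks (P \<alpha>) i = \<alpha>"
proof -
  let ?B = "if i < U then {i} else {U..<n}"
  have "exit_mass user_item_blocks (P \<alpha>) i = (\<Sum>l\<in>{..<n} - ?B. P \<alpha> $$ (i, l))"
    using P_carrier[of \<alpha>] block_of_user_item_blocks[OF i] by (simp add: exit_mass_def)
  \<comment> \<open>\<open>M\<close> has no mass outside the block: a user row is an identity row,
    and an item row is supported on items.\<close>
  also have "\<dots> = (\<Sum>l\<in>{..<n} - ?B. \<alpha> * H $$ (i, l))"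
    using i by (intro sum.cong) (auto simp: P_index M_index split: if_splits)
  \<comment> \<open>Both ends of a transition within a block are on the same side, where
    \<open>H\<close> vanishes, so the sum extends to a full row.\<close>
  also have "\<dots> = (\<Sum>l<n. \<alpha> * H $$ (i, l))"
    using i H_changes_side[OF i] by (intro sum.mono_neutral_left) (auto split: if_splits)
  also have "\<dots> = \<alpha>" using H_sum[OF i] by (simp add: sum_distrib_left[symmetric])
  finally show ?thesis .
qed

lemma max_coupling_recwalk: "max_coupling user_item_blocks (P \<alpha>) = \<alpha>"
proof -
  \<comment> \<open>A state exists since \<open>U \<ge> 1\<close>, so the maximum is over a
    singleton and not over the empty set.\<close>
  have "exit_mass user_item_blocks (P \<alpha>) ` {..<n} = {\<alpha>}"
    using exit_mass_recwalk U by (auto simp: image_iff intro!: bexI[of _ 0])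
  then show ?thesis using P_carrier[of \<alpha>] by (simp add: max_coupling_def)
qed

lemma nearly_uncoupled_recwalk:
  assumes "\<alpha> \<le> \<delta>"
  shows "nearly_uncoupled \<delta> user_item_blocks (P \<alpha>)"
proof -
  have dim: "dim_row (P \<alpha>) = n" using P_carrier[of \<alpha>] by simp
  note part = partition_user_item_blocks[folded dim]
  have "max_coupling user_item_blocks (P \<alpha>) \<noteq> 0" using max_coupling_recwalk \<alpha> by simp
  from ex_uncoupling_decomposition[OF stochastic_recwalk part this] assms show ?thesis
    unfolding nearly_uncoupled_def max_coupling_recwalk
    using stochastic_recwalk irreducible_recwalk aperiodic_recwalk part by blast
qed

end

end

theorem theorem5p1:
  fixes U I :: nat and R W :: "real mat"
  assumes "U \<ge> 1" and "I \<ge> 1"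
    and "R \<in> carrier_mat U I"
    and "\<forall>u<U. \<forall>i<I. R $$ (u, i) \<in> {0, 1}"
    and "\<forall>u<U. row R u \<noteq> 0\<^sub>v I"
    and "\<forall>i<I. col R i \<noteq> 0\<^sub>v U"
    and "Digraph_Component.connected (with_proj (bip_network R))"
    and "W \<in> carrier_mat I I"
    and "\<forall>i<I. \<forall>j<I. W $$ (i, j) \<ge> 0"
    and "W \<noteq> 0\<^sub>m I I"
  shows "(\<forall>\<alpha>::real. 0 < \<alpha> \<and> \<alpha> < 1 \<longrightarrow>
            complex_of_real (1 - 2 * \<alpha>) \<in> eigenvalues (recwalk R W \<alpha>)) \<and>
         (\<forall>\<delta>::real. \<delta> > 0 \<longrightarrow>
            (\<exists>\<alpha>\<^sub>0. 0 < \<alpha>\<^sub>0 \<and> \<alpha>\<^sub>0 < 1 \<and>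
               (\<forall>\<alpha>. 0 < \<alpha> \<and> \<alpha> < \<alpha>\<^sub>0 \<longrightarrow>
                  (\<exists>Q. partition_on {..<U + I} Q \<and> card Q \<ge> U + 1 \<and>
                       nearly_uncoupled \<delta> Q (recwalk R W \<alpha>)))))"
proof -
  interpret recwalk_data U I R W by unfold_locales (fact assms)+
  show ?thesis
  proof (intro conjI allI impI)
    fix \<alpha> :: real
    show "complex_of_real (1 - 2 * \<alpha>) \<in> eigenvalues (recwalk R W \<alpha>)"
      by (rule eigenvalue_recwalk)
  next
    fix \<delta> :: real
    assume \<delta>: "\<delta> > 0"
    \<comment> \<open>The coupling equals \<open>\<alpha>\<close>, so the threshold need only stay
      at most \<open>\<delta>\<close>; the bound \<open>1 / 2\<close> keeps it below 1.\<close>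
    have "partition_on {..<U + I} user_item_blocks \<and> card user_item_blocks \<ge> U + 1 \<and>
        nearly_uncoupled \<delta> user_item_blocks (recwalk R W \<alpha>)"
      if "0 < \<alpha> \<and> \<alpha> < min \<delta> (1 / 2)" for \<alpha>
      using that nearly_uncoupled_recwalk partition_user_item_blocks card_user_item_blocks by simp
    with \<delta> show "\<exists>\<alpha>\<^sub>0. 0 < \<alpha>\<^sub>0 \<and> \<alpha>\<^sub>0 < 1 \<and>
        (\<forall>\<alpha>. 0 < \<alpha> \<and> \<alpha> < \<alpha>\<^sub>0 \<longrightarrow>
          (\<exists>Q. partition_on {..<U + I} Q \<and> card Q \<ge> U + 1 \<and>
            nearly_uncoupled \<delta> Q (recwalk R W \<alpha>)))"
      by (intro exI[of _ "min \<delta> (1 / 2)"]) auto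
  qed
qed

end
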